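(* Assume that the infinite waveguide is initially in its vacuum state, $|\tilde\Psi(0)\rangle=|\tilde\psi(0)\rangle\otimes|\mathbf0\rangle\otimes|\mathbf0\rangle$. Then the non-Markovian It\^o rule for atoms coupled to an infinite waveguide via multiple points reads $$\mathrm{d}C_{\rm m,in}^{(j)}(t)\,\mathrm{d}C_{\rm m,in}^{(l)\dagger}(t)=\int_t^{t+\mathrm{d}t}\int_t^{t+\mathrm{d}t}\left[c_{\rm m,in}^{(j)}(s),c_{\rm m,in}^{(l)\dagger}(\mu)\right]\mathrm{d}s\,\mathrm{d}\mu,$$ $$\mathrm{d}D_{\rm m,in}^{(j)}(t)\,\mathrm{d}D_{\rm m,in}^{(l)\dagger}(t)=\int_t^{t+\mathrm{d}t}\int_t^{t+\mathrm{d}t}\left[d_{\rm m,in}^{(j)}(s),d_{\rm m,in}^{(l)\dagger}(\mu)\right]\mathrm{d}s\,\mathrm{d}\mu,$$ where $$\left[c_{\rm m,in}^{(j)}(s),c_{\rm m,in}^{(l)\dagger}(\mu)\right]=\int_0^s\hat\eta_j^*(s-\nu)\hat\eta_l(\mu-\nu)\,\mathrm{d}\nu,\qquad \left[d_{\rm m,in}^{(j)}(s),d_{\rm m,in}^{(l)\dagger}(\mu)\right]=\int_0^s\breve\eta_j^*(s-\nu)\breve\eta_l(\mu-\nu)\,\mathrm{d}\nu,$$ and $$\hat\eta_j(\mu-\nu)=\sum_{n=1}^{\mathbf n_j}\sqrt{\gamma_{jR}^{(n)}}\,\delta\!\left(\mu-\nu-\frac{z_j^{(n)}}{c}\right),\qquad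 \breve\eta_j(\mu-\nu)=\sum_{n=1}^{\mathbf n_j}\sqrt{\gamma_{jL}^{(n)}}\,\delta\!\left(\mu-\nu+\frac{z_j^{(n)}}{c}\right).$$ Besides, $\mathrm{d}C_{\rm m,in}^{(j)}\mathrm{d}C_{\rm m,in}^{(l)}=\mathrm{d}C_{\rm m,in}^{(j)\dagger}\mathrm{d}C_{\rm m,in}^{(l)\dagger}=\mathrm{d}C_{\rm m,in}^{(l)\dagger}\mathrm{d}C_{\rm m,in}^{(j)}=0$ and $\mathrm{d}D_{\rm m,in}^{(j)}\mathrm{d}D_{\rm m,in}^{(l)}=\mathrm{d}D_{\rm m,in}^{(j)\dagger}\mathrm{d}D_{\rm m,in}^{(l)\dagger}=\mathrm{d}D_{\rm m,in}^{(l)\dagger}\mathrm{d}D_{\rm m,in}^{(j)}=0$.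
   Context: $N$ two-level atoms are coupled to an infinite waveguide; atom $j$ is coupled at the points $z_j^{(1)}<z_j^{(2)}<\dots<z_j^{(\mathbf n_j)}$, with coupling strengths $\gamma_{jR}^{(n)},\gamma_{jL}^{(n)}\ge0$ to the right- and left-propagating modes at its $n$th point; $c>0$ is the propagation speed. The right- and left-propagating input fields $c_{\rm in},d_{\rm in}$ are independent bosonic fields with $[c_{\rm in}(t),c_{\rm in}^\dagger(t')]=[d_{\rm in}(t),d_{\rm in}^\dagger(t')]=\delta(t-t')$, all other commutators zero, and annihilate the respective vacua $|\mathbf0\rangle$ of the right- and left-propagating modes; $|\tilde\psi(0)\rangle$ is the initial atomic state. The $j$th input noise channels are $$c_{\rm m,in}^{(j)}(t)=\sum_{n=1}^{\mathbf n_j}\sqrt{\gamma_{jR}^{(n)}}\,c_{\rm in}(t-z_j^{(n)}/c),\qquad d_{\rm m,in}^{(j)}(t)=\sum_{n=1}^{\mathbf n_j}\sqrt{\gamma_{jL}^{(n)}}\,d_{\rm in}(t+z_j^{(n)}/c),$$ i.e. their adjoints are the convolutions of $\hat\eta_j$ with $c_{\rm in}^\dagger$ and of $\breve\eta_j$ with $d_{\rm in}^\dagger$. Convention: integrals of the form $\int_0^t\delta(t-\nu\mp z/c)f(\nu)\,\mathrm{d}\nu$ are evaluated formally as $f(t\mp z/c)$. The increments are $\mathrm{d}C_{\rm m,in}^{(j)}(t)=\int_t^{t+\mathrm{d}t}c_{\rm m,in}^{(j)}(s)\,\mathrm{d}s$ and $\mathrm{d}D_{\rm m,in}^{(j)}(t)=\int_t^{t+\mathrm{d}t}d_{\rm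 m,in}^{(j)}(s)\,\mathrm{d}s$ with $\mathrm{d}t>0$ a small time step. Products of increments are It\^o products with respect to the vacuum state. *)

theory Defs
  imports "HOL-Analysis.Analysis"
begin

section \<open>Complex inner product spaces\<close>

text \<open>
  Completeness is not required:
  a type of this class plays the role of the common invariant domain of the unbounded field
  operators (for the Fock representation: the finite-particle vectors), so that operators are total
  functions that can be composed. The inner product is conjugate-linear in its first argument.
\<close>

class complex_inner = ab_group_add +
  fixes scaleC :: "complex \<Rightarrow> 'a \<Rightarrow> 'a"  (infixr \<open>*\<^sub>C\<close> 75)
    and cinner :: "'a \<Rightarrow> 'a \<Rightarrow> complex"
  assumes scaleC_add_right: "a *\<^sub>C (x + y) = a *\<^sub>C x + a *\<^sub>C y"
    and scaleC_add_left: "(a + b) *\<^sub>C x = a *\<^sub>C x + b *\<^sub>C x"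
    and scaleC_scaleC: "a *\<^sub>C b *\<^sub>C x = (a * b) *\<^sub>C x"
    and scaleC_one: "1 *\<^sub>C x = x"
    and cinner_commute: "cinner x y = cnj (cinner y x)"
    and cinner_add_right: "cinner x (y + z) = cinner x y + cinner x z"
    and cinner_scaleC_right: "cinner x (a *\<^sub>C y) = a * cinner x y"
    and cinner_ge_zero: "0 \<le> Re (cinner x x)"
    and cinner_eq_zero: "cinner x x = 0 \<Longrightarrow> x = 0"

global_interpretation complex_vector: vector_space "scaleC :: complex \<Rightarrow> 'a \<Rightarrow> 'a::complex_inner"
  by standard (simp_all add: scaleC_add_right scaleC_add_left scaleC_scaleC scaleC_one)

abbreviation clinear :: "('a::complex_inner \<Rightarrow> 'b::complex_inner) \<Rightarrow> bool" where
  "clinear X \<equiv> Vector_Spaces.linear (*\<^sub>C) (*\<^sub>C) X"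

instantiation complex :: complex_inner
begin
definition "scaleC_complex (a::complex) (x::complex) = a * x"
definition "cinner_complex (x::complex) (y::complex) = cnj x * y"
instance
  by standard (auto simp: scaleC_complex_def cinner_complex_def algebra_simps)
end

instantiation vec :: (complex_inner, finite) complex_inner
begin
definition "scaleC_vec a (x :: 'a ^ 'b) = (\<chi> i. a *\<^sub>C (x $ i))"
definition "cinner_vec (x :: 'a ^ 'b) (y :: 'a ^ 'b) = (\<Sum>i\<in>UNIV. cinner (x $ i) (y $ i))"
instance
proof
  fix x y z :: "'a ^ 'b" and a b :: complex
  show "a *\<^sub>C (x + y) = a *\<^sub>C x + a *\<^sub>C y" "(a + b) *\<^sub>C x = a *\<^sub>C x + b *\<^sub>C x"
    "a *\<^sub>C b *\<^sub>C x = (a * b) *\<^sub>C x" "1 *\<^sub>C x = x"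
    by (simp_all add: scaleC_vec_def vec_eq_iff scaleC_add_right scaleC_add_left
        scaleC_scaleC scaleC_one)
  show "cinner x y = cnj (cinner y x)"
    unfolding cinner_vec_def cnj_sum by (rule sum.cong[OF refl]) (rule cinner_commute)
  show "cinner x (y + z) = cinner x y + cinner x z" "cinner x (a *\<^sub>C y) = a * cinner x y"
    by (simp_all add: cinner_vec_def scaleC_vec_def cinner_add_right cinner_scaleC_right
        sum.distrib sum_distrib_left)
  show "0 \<le> Re (cinner x x)"
    by (auto simp: cinner_vec_def intro!: sum_nonneg cinner_ge_zero)
  assume "cinner x x = 0"
  then have "(\<Sum>i\<in>UNIV. Re (cinner (x $ i) (x $ i))) = 0"
    by (metis Re_sum cinner_vec_def zero_complex.simps(1))
  then have re: "Re (cinner (x $ i) (x $ i)) = 0" for i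
    by (simp add: sum_nonneg_eq_0_iff cinner_ge_zero)
  have "cinner (x $ i) (x $ i) = 0" for i
    using re[of i] arg_cong[where f = Im, OF cinner_commute[of "x $ i" "x $ i"]]
    by (intro complex_eqI) simp_all
  then show "x = 0"
    unfolding vec_eq_iff zero_index by (blast intro: cinner_eq_zero)
qed
end


section \<open>Operators\<close>

type_synonym 'h operator = "'h \<Rightarrow> 'h"

definition is_adjoint :: "'h::complex_inner operator \<Rightarrow> 'h operator \<Rightarrow> bool" where
  "is_adjoint X Y \<longleftrightarrow> (\<forall>u v. cinner (X u) v = cinner u (Y v))"

definition adj :: "'h::complex_inner operator \<Rightarrow> 'h operator" where
  "adj X = (THE Y. is_adjoint X Y)"

definition commutator :: "'h::complex_inner operator \<Rightarrow> 'h operator \<Rightarrow> 'h operator" where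
  "commutator X Y = (\<lambda>u. X (Y u) - Y (X u))"


section \<open>Delta combs\<close>

text \<open>
  A distribution \<open>\<eta>\<close> on the real line is represented by the functional
  \<open>f \<mapsto> \<integral> \<eta>(x) f(x) dx\<close>; \<open>dirac a\<close> is \<open>\<delta>(x - a)\<close>.
\<close>

type_synonym distr = "(real \<Rightarrow> complex) \<Rightarrow> complex"

definition dirac :: "real \<Rightarrow> distr" where
  "dirac a f = f a"

text \<open>The comb \<open>\<Sum>\<^sub>n \<surd>\<gamma>\<^sub>n \<delta>(x - \<tau>\<^sub>n)\<close>.\<close>

definition delta_comb :: "nat \<Rightarrow> (nat \<Rightarrow> real) \<Rightarrow> (nat \<Rightarrow> real) \<Rightarrow> distr" where
  "delta_comb N \<gamma> \<tau> f = (\<Sum>n=1..N. complex_of_real (sqrt (\<gamma> n)) * dirac (\<tau> n) f)"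

definition conj_distr :: "distr \<Rightarrow> distr" where
  "conj_distr \<eta> f = cnj (\<eta> (\<lambda>x. cnj (f x)))"

text \<open>
  \<open>formal_conv \<eta> f s\<close> is \<open>\<integral>\<^sub>0\<^sup>s \<eta>(s - \<nu>) f(\<nu>) d\<nu>\<close> under the convention that
  \<open>\<integral>\<^sub>0\<^sup>s \<delta>(s - \<nu> - a) f(\<nu>) d\<nu>\<close> is evaluated formally as \<open>f(s - a)\<close>, for either sign of \<open>a\<close>
  and whether or not \<open>s - a\<close> lies between \<open>0\<close> and \<open>s\<close>.
\<close>

definition formal_conv :: "distr \<Rightarrow> (real \<Rightarrow> complex) \<Rightarrow> real \<Rightarrow> complex" where
  "formal_conv \<eta> f s = \<eta> (\<lambda>x. f (s - x))"

lemma formal_conv_dirac: "formal_conv (dirac a) f s = f (s - a)"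
  by (simp add: formal_conv_def dirac_def)

text \<open>
  A distribution kernel \<open>K(s, \<mu>)\<close> is represented by \<open>K s \<psi> = \<integral> K(s, \<mu>) \<psi>(\<mu>) d\<mu>\<close>; so
  \<open>dirac\<close>, read as a kernel, is \<open>\<delta>(s - \<mu>)\<close>. The kernel below is
  \<open>\<integral>\<^sub>0\<^sup>s \<eta>\<^sub>1\<^sup>*(s - \<nu>) \<eta>\<^sub>2(\<mu> - \<nu>) d\<nu>\<close>: integrating \<open>\<eta>\<^sub>2(\<mu> - \<nu>)\<close> against \<open>\<psi>(\<mu>)\<close> gives the
  function \<open>\<nu> \<mapsto> \<eta>\<^sub>2 (\<lambda>x. \<psi> (\<nu> + x))\<close>.
\<close>

type_synonym kernel = "real \<Rightarrow> distr"

definition comb_kernel :: "distr \<Rightarrow> distr \<Rightarrow> kernel" where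
  "comb_kernel \<eta>\<^sub>1 \<eta>\<^sub>2 s \<psi> = formal_conv (conj_distr \<eta>\<^sub>1) (\<lambda>\<nu>. \<eta>\<^sub>2 (\<lambda>x. \<psi> (\<nu> + x))) s"

text \<open>The double integral of \<open>K(s, \<mu>)\<close> over \<open>t \<le> s, \<mu> \<le> t + dt\<close>.\<close>

definition box_integral :: "kernel \<Rightarrow> real \<Rightarrow> real \<Rightarrow> complex" where
  "box_integral K t dt = (LINT s:{t..t + dt}|lborel. K s (indicator {t..t + dt}))"


section \<open>Quantum fields\<close>

text \<open>
  A field \<open>c(t)\<close> is an operator-valued distribution, \<open>F \<phi> = \<integral> \<phi>(t) c(t) dt\<close> (linear in \<open>\<phi>\<close>),
  with square-integrable test functions; hence \<open>\<integral> \<phi>(t) c\<^sup>\<dagger>(t) dt\<close> is the adjoint of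
  \<open>\<integral> \<phi>\<^sup>*(t) c(t) dt\<close>.
\<close>

type_synonym 'h field = "(real \<Rightarrow> complex) \<Rightarrow> 'h operator"

definition test_fun :: "(real \<Rightarrow> complex) set" where
  "test_fun = {\<phi>. \<phi> \<in> borel_measurable borel \<and> integrable lborel (\<lambda>x. (cmod (\<phi> x))\<^sup>2)}"

definition operator_distribution :: "'h::complex_inner field \<Rightarrow> bool" where
  "operator_distribution F \<longleftrightarrow>
     (\<forall>\<phi>\<in>test_fun. clinear (F \<phi>) \<and> (\<exists>Y. is_adjoint (F \<phi>) Y)) \<and>
     (\<forall>\<phi>\<in>test_fun. \<forall>\<psi>\<in>test_fun. \<forall>a b u.
        F (\<lambda>x. a * \<phi> x + b * \<psi> x) u = a *\<^sub>C F \<phi> u + b *\<^sub>C F \<psi> u)"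

definition field_adj :: "'h::complex_inner field \<Rightarrow> 'h field" where
  "field_adj F \<phi> = adj (F (\<lambda>x. cnj (\<phi> x)))"

text \<open>\<open>[F(s), G(\<mu>)] = K(s, \<mu>)\<close> as distributions in \<open>s\<close> and \<open>\<mu>\<close>.\<close>

definition has_commutator :: "'h::complex_inner field \<Rightarrow> 'h field \<Rightarrow> kernel \<Rightarrow> bool" where
  "has_commutator F G K \<longleftrightarrow>
     (\<forall>\<phi>\<in>test_fun. \<forall>\<psi>\<in>test_fun. \<forall>u.
        commutator (F \<phi>) (G \<psi>) u = (LINT s|lborel. \<phi> s * K s \<psi>) *\<^sub>C u)"

abbreviation fields_commute :: "'h::complex_inner field \<Rightarrow> 'h field \<Rightarrow> bool" where
  "fields_commute F G \<equiv> has_commutator F G (\<lambda>s \<psi>. 0)"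

definition bosonic_field :: "'h::complex_inner field \<Rightarrow> bool" where
  "bosonic_field F \<longleftrightarrow>
     operator_distribution F \<and>
     has_commutator F (field_adj F) dirac \<and>
     fields_commute F F \<and> fields_commute (field_adj F) (field_adj F)"

definition independent_fields :: "'h::complex_inner field \<Rightarrow> 'h field \<Rightarrow> bool" where
  "independent_fields F G \<longleftrightarrow>
     fields_commute F G \<and> fields_commute F (field_adj G) \<and>
     fields_commute (field_adj F) G \<and> fields_commute (field_adj F) (field_adj G)"

text \<open>
  The field \<open>\<Sum>\<^sub>n \<surd>\<gamma>\<^sub>n F(t - \<tau>\<^sub>n)\<close>: testing \<open>F(t - \<tau>)\<close> against \<open>\<phi>(t)\<close> means testing \<open>F(s)\<close>
  against \<open>\<phi>(s + \<tau>)\<close>.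
\<close>

definition noise_channel ::
    "nat \<Rightarrow> (nat \<Rightarrow> real) \<Rightarrow> (nat \<Rightarrow> real) \<Rightarrow> 'h::complex_inner field \<Rightarrow> 'h field" where
  "noise_channel N \<gamma> \<tau> F \<phi> u =
     (\<Sum>n=1..N. complex_of_real (sqrt (\<gamma> n)) *\<^sub>C F (\<lambda>s. \<phi> (s + \<tau> n)) u)"

definition increment :: "'h field \<Rightarrow> real \<Rightarrow> real \<Rightarrow> 'h operator" where
  "increment F t dt = F (indicator {t..t + dt})"


section \<open>Atoms and waveguide\<close>

text \<open>
  The \<open>N\<close> atoms are the elements of a finite type \<open>'n\<close>. Their state space has as orthonormal
  basis the excitation patterns \<open>'n \<Rightarrow> bool\<close>.
\<close>

type_synonym 'n atoms = "complex ^ ('n \<Rightarrow> bool)"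

text \<open>
  \<open>T a r l\<close> is \<open>a \<otimes> r \<otimes> l\<close> in the (algebraic) tensor product \<open>'h\<close> of the atomic space and the
  spaces of the right- and left-propagating modes; the locale determines \<open>'h\<close> up to isomorphism.
\<close>

locale tensor3 =
  fixes T :: "'a::complex_inner \<Rightarrow> 'r::complex_inner \<Rightarrow> 'l::complex_inner \<Rightarrow> 'h::complex_inner"
  assumes linear_atoms: "clinear (\<lambda>a. T a r l)"
    and linear_right: "clinear (\<lambda>r. T a r l)"
    and linear_left: "clinear (\<lambda>l. T a r l)"
    and cinner_tensor: "cinner (T a r l) (T a' r' l') = cinner a a' * cinner r r' * cinner l l'"
    and span_tensor: "complex_vector.span {T a r l | a r l. True} = UNIV"

locale waveguide = tensor3 T
  for T :: "'n::finite atoms \<Rightarrow> 'r::complex_inner \<Rightarrow> 'l::complex_inner \<Rightarrow> 'h::complex_inner" +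
  fixes vac\<^sub>R :: 'r and vac\<^sub>L :: 'l and c_in d_in :: "'h field"
  assumes vacuum_normalized: "cinner vac\<^sub>R vac\<^sub>R = 1" "cinner vac\<^sub>L vac\<^sub>L = 1"
    and bosonic: "bosonic_field c_in" "bosonic_field d_in"
    and independent: "independent_fields c_in d_in"
    and right_field: "\<phi> \<in> test_fun \<Longrightarrow>
          \<exists>X. (\<forall>a r l. c_in \<phi> (T a r l) = T a (X r) l) \<and> X vac\<^sub>R = 0"
    and left_field: "\<phi> \<in> test_fun \<Longrightarrow>
          \<exists>X. (\<forall>a r l. d_in \<phi> (T a r l) = T a r (X l)) \<and> X vac\<^sub>L = 0"

text \<open>
  Equality of two (products of) operators in the sense of Ito products with respect to the vacuum
  state, for the initial state \<open>\<psi>\<^sub>0 \<otimes> vac\<^sub>R \<otimes> vac\<^sub>L\<close>: the operators are compared after taking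
  the vacuum expectation over both families of modes, which leaves the atomic operator with matrix
  elements \<open>\<langle>\<xi> \<otimes> vac\<^sub>R \<otimes> vac\<^sub>L| X |\<psi>\<^sub>0 \<otimes> vac\<^sub>R \<otimes> vac\<^sub>L\<rangle>\<close>.
\<close>

definition ito_eq ::
    "('a \<Rightarrow> 'r \<Rightarrow> 'l \<Rightarrow> 'h::complex_inner) \<Rightarrow> 'r \<Rightarrow> 'l \<Rightarrow> 'h \<Rightarrow> 'h operator \<Rightarrow> 'h operator \<Rightarrow> bool" where
  "ito_eq T vac\<^sub>R vac\<^sub>L \<Psi>\<^sub>0 X Y \<longleftrightarrow>
     (\<forall>\<xi>. cinner (T \<xi> vac\<^sub>R vac\<^sub>L) (X \<Psi>\<^sub>0) = cinner (T \<xi> vac\<^sub>R vac\<^sub>L) (Y \<Psi>\<^sub>0))"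

end

theory Submission
  imports Defs
begin

text \<open>
  The channel \<open>\<Sum>\<^sub>n \<surd>\<gamma>\<^sub>n F(t - \<tau>\<^sub>n)\<close> is a finite combination of translates of the input field, so
  its commutator with the adjoint of another channel is obtained by expanding bilinearly, inserting
  \<open>[F(s), F\<^sup>\<dagger>(\<mu>)] = \<delta>(s - \<mu>)\<close> and translating the integration variable. Every increment annihilates
  the vacuum, hence \<open>dC\<^sub>j dC\<^sub>l\<^sup>\<dagger> \<Psi>\<^sub>0 = [dC\<^sub>j, dC\<^sub>l\<^sup>\<dagger>] \<Psi>\<^sub>0\<close>, and any product with an annihilator on
  the right or a creator on the left has vanishing vacuum expectation.
\<close>

section \<open>Adjoints\<close>

lemma cinner_zero_right [simp]: "cinner x 0 = 0"
  using cinner_add_right[of x 0 0] by simp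

lemma cinner_zero_left [simp]: "cinner 0 x = 0"
  using cinner_commute[of 0 x] by simp

lemma cinner_add_left: "cinner (x + y) z = cinner x z + cinner y z"
  by (metis cinner_commute cinner_add_right complex_cnj_add)

lemma cinner_scaleC_left: "cinner (a *\<^sub>C x) y = cnj a * cinner x y"
  by (metis cinner_commute cinner_scaleC_right complex_cnj_mult)

lemma cinner_diff_right: "cinner x (y - z) = cinner x y - cinner x z"
  using cinner_add_right[of x "y - z" z] by simp

lemma cinner_sum_right: "cinner x (\<Sum>i\<in>A. f i) = (\<Sum>i\<in>A. cinner x (f i))"
  by (induction A rule: infinite_finite_induct) (simp_all add: cinner_add_right)

lemma cinner_sum_left: "cinner (\<Sum>i\<in>A. f i) x = (\<Sum>i\<in>A. cinner (f i) x)"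
  by (induction A rule: infinite_finite_induct) (simp_all add: cinner_add_left)

lemma cinner_ext:
  assumes "\<And>u. cinner u x = cinner u y"
  shows "x = y"
proof -
  have "cinner (x - y) (x - y) = 0"
    by (simp add: cinner_diff_right assms)
  then show ?thesis
    using cinner_eq_zero by fastforce
qed

text \<open>Nondegeneracy of the inner product makes adjoints unique, so exhibiting any candidate
  satisfies the definite description in \<open>adj\<close>.\<close>

lemma adj_eqI:
  assumes "is_adjoint X Y"
  shows "adj X = Y"
  unfolding adj_def
proof (rule the_equality, rule assms)
  fix Z assume "is_adjoint X Z"
  show "Z = Y"
  proof (rule ext, rule cinner_ext)
    show "cinner u (Z v) = cinner u (Y v)" for u v
      using assms \<open>is_adjoint X Z\<close> by (metis is_adjoint_def)
  qed
qed

text \<open>The pairing \<open>cinner (X u) v\<close> is linear in \<open>v\<close>, and pairings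
  with all \<open>u\<close> determine a vector. This supplies linearity of the creation operators,
  whose linearity is not an axiom of the fields.\<close>

lemma is_adjoint_clinear:
  assumes "is_adjoint X Y"
  shows "clinear Y"
proof -
  have Y: "cinner u (Y v) = cinner (X u) v" for u v
    using assms by (simp add: is_adjoint_def)
  show ?thesis
    by (unfold_locales; rule cinner_ext; simp add: Y cinner_add_right cinner_scaleC_right)
qed

lemma clinear_sum:
  assumes "clinear X"
  shows "X (\<Sum>i\<in>A. f i) = (\<Sum>i\<in>A. X (f i))"
  using assms by (metis Vector_Spaces.linear_iff_module_hom module_hom.sum)

lemma clinear_scale:
  assumes "clinear X"
  shows "X (a *\<^sub>C u) = a *\<^sub>C X u"
  using assms by (metis Vector_Spaces.linear_iff_module_hom module_hom.scale)

lemma clinear_zero: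
  assumes "clinear X"
  shows "X 0 = 0"
  using assms by (metis Vector_Spaces.linear_iff_module_hom module_hom.zero)

lemma is_adjoint_sum:
  assumes "\<And>i. i \<in> A \<Longrightarrow> is_adjoint (X i) (Y i)"
  shows "is_adjoint (\<lambda>u. \<Sum>i\<in>A. a i *\<^sub>C X i u) (\<lambda>u. \<Sum>i\<in>A. cnj (a i) *\<^sub>C Y i u)"
  using assms
  by (simp add: is_adjoint_def cinner_sum_left cinner_sum_right cinner_scaleC_left
      cinner_scaleC_right cong: sum.cong)

lemma commutator_sum:
  assumes "\<And>i. i \<in> A \<Longrightarrow> clinear (X i)" "\<And>k. k \<in> B \<Longrightarrow> clinear (Y k)"
  shows "commutator (\<lambda>u. \<Sum>i\<in>A. a i *\<^sub>C X i u) (\<lambda>u. \<Sum>k\<in>B. b k *\<^sub>C Y k u) u =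
    (\<Sum>i\<in>A. \<Sum>k\<in>B. (a i * b k) *\<^sub>C commutator (X i) (Y k) u)"
proof -
  have "(\<Sum>i\<in>A. a i *\<^sub>C X i (\<Sum>k\<in>B. b k *\<^sub>C Y k u)) =
      (\<Sum>i\<in>A. \<Sum>k\<in>B. (a i * b k) *\<^sub>C X i (Y k u))"
    by (intro sum.cong refl)
      (simp add: assms(1) clinear_sum clinear_scale complex_vector.scale_sum_right)
  moreover have "(\<Sum>k\<in>B. b k *\<^sub>C Y k (\<Sum>i\<in>A. a i *\<^sub>C X i u)) =
      (\<Sum>k\<in>B. \<Sum>i\<in>A. (a i * b k) *\<^sub>C Y k (X i u))"
    by (intro sum.cong refl)
      (simp add: assms(2) clinear_sum clinear_scale complex_vector.scale_sum_right mult.commute)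
  \<comment> \<open>The second product expands with \<open>B\<close> outermost; swapping the sums
    lets the two orders be subtracted term by term.\<close>
  moreover have "\<dots> = (\<Sum>i\<in>A. \<Sum>k\<in>B. (a i * b k) *\<^sub>C Y k (X i u))"
    by (rule sum.swap)
  ultimately show ?thesis
    by (simp add: commutator_def complex_vector.scale_right_diff_distrib sum_subtractf)
qed


section \<open>Test functions\<close>

lemma test_fun_shift:
  assumes "\<phi> \<in> test_fun"
  shows "(\<lambda>s. \<phi> (s + a)) \<in> test_fun"
  using assms lborel_integrable_real_affine[of "\<lambda>x. (cmod (\<phi> x))\<^sup>2" 1 a]
  by (auto simp: test_fun_def add.commute)

lemma test_fun_cnj:
  assumes "\<phi> \<in> test_fun"
  shows "(\<lambda>s. cnj (\<phi> s)) \<in> test_fun"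
proof -
  have "cnj \<in> borel_measurable borel"
    by (intro borel_measurable_continuous_onI continuous_intros)
  from measurable_compose[OF _ this, of \<phi>] assms show ?thesis
    by (auto simp: test_fun_def)
qed

lemma test_fun_indicator: "indicator {t..t + dt} \<in> test_fun"
proof -
  have "(cmod (indicator {t..t + dt} x))\<^sup>2 = indicator {t..t + dt} x" for x :: real
    by (simp add: indicator_def)
  moreover have "integrable lborel (indicat_real {t..t + dt})"
    by (intro integrable_real_indicator) (auto simp: emeasure_lborel_Icc_eq)
  ultimately show ?thesis
    by (auto simp: test_fun_def)
qed

text \<open>The product is dominated by the sum of the two squared moduli. Integrability is what
  later allows finite sums to pass through the pairing integral.\<close>

lemma integrable_test_fun_mult:
  assumes "\<phi> \<in> test_fun" "\<psi> \<in> test_fun"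
  shows "integrable lborel (\<lambda>s. \<phi> s * \<psi> s)"
proof (rule Bochner_Integration.integrable_bound)
  show "integrable lborel (\<lambda>s. (cmod (\<phi> s))\<^sup>2 + (cmod (\<psi> s))\<^sup>2)"
    using assms by (auto simp: test_fun_def)
  show "(\<lambda>s. \<phi> s * \<psi> s) \<in> borel_measurable lborel"
    using assms by (auto simp: test_fun_def)
  have "x * y \<le> x\<^sup>2 + y\<^sup>2" for x y :: real
    using sum_squares_bound[of x y] sum_squares_bound[of x "- y"] zero_le_power2[of x]
      zero_le_power2[of y] by linarith
  then show "AE s in lborel. cmod (\<phi> s * \<psi> s) \<le> norm ((cmod (\<phi> s))\<^sup>2 + (cmod (\<psi> s))\<^sup>2)"
    by (simp add: norm_mult)
qed


section \<open>Noise channels\<close>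

text \<open>Each smeared field has an adjoint by \<open>operator_distribution\<close>; the weights
  are real, so conjugation leaves them unchanged.\<close>

lemma adj_noise_channel:
  assumes "operator_distribution F" "\<phi> \<in> test_fun"
  shows "is_adjoint (noise_channel N \<gamma> \<tau> F \<phi>) (adj (noise_channel N \<gamma> \<tau> F \<phi>))"
    and "adj (noise_channel N \<gamma> \<tau> F \<phi>) =
      (\<lambda>u. \<Sum>n=1..N. complex_of_real (sqrt (\<gamma> n)) *\<^sub>C adj (F (\<lambda>s. \<phi> (s + \<tau> n))) u)"
proof -
  have "is_adjoint (F \<psi>) (adj (F \<psi>))" if "\<psi> \<in> test_fun" for \<psi>
    using assms(1) that adj_eqI unfolding operator_distribution_def by metis
  then have *: "is_adjoint (noise_channel N \<gamma> \<tau> F \<phi>)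
      (\<lambda>u. \<Sum>n=1..N. complex_of_real (sqrt (\<gamma> n)) *\<^sub>C adj (F (\<lambda>s. \<phi> (s + \<tau> n))) u)"
    using is_adjoint_sum[of "{1..N}" "\<lambda>n. F (\<lambda>s. \<phi> (s + \<tau> n))" _
        "\<lambda>n. complex_of_real (sqrt (\<gamma> n))"] test_fun_shift[OF assms(2)]
    by (simp add: noise_channel_def[abs_def])
  show "adj (noise_channel N \<gamma> \<tau> F \<phi>) =
      (\<lambda>u. \<Sum>n=1..N. complex_of_real (sqrt (\<gamma> n)) *\<^sub>C adj (F (\<lambda>s. \<phi> (s + \<tau> n))) u)"
    using * by (rule adj_eqI)
  with * show "is_adjoint (noise_channel N \<gamma> \<tau> F \<phi>) (adj (noise_channel N \<gamma> \<tau> F \<phi>))"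
    by simp
qed

text \<open>Translating a test function commutes with conjugating it. Thus the adjoint channel is
  again a channel, built from the creation field with the same weights and delays.\<close>

lemma field_adj_noise_channel:
  assumes "operator_distribution F" "\<phi> \<in> test_fun"
  shows "field_adj (noise_channel N \<gamma> \<tau> F) \<phi> = noise_channel N \<gamma> \<tau> (field_adj F) \<phi>"
  using adj_noise_channel(2)[OF assms(1) test_fun_cnj[OF assms(2)]]
  by (simp add: field_adj_def noise_channel_def fun_eq_iff)

text \<open>By the formal convention no delta is cut off at the ends of the interval from 0 to s, so
  every pair of coupling points contributes one translate of \<psi>.\<close>

lemma comb_kernel_delta_comb:
  "comb_kernel (delta_comb N \<gamma> \<tau>) (delta_comb N' \<gamma>' \<tau>') s \<psi> =
    (\<Sum>n=1..N. \<Sum>m=1..N'. complex_of_real (sqrt (\<gamma> n)) * complex_of_real (sqrt (\<gamma>' m)) *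
      \<psi> (s - \<tau> n + \<tau>' m))"
  by (simp add: comb_kernel_def formal_conv_def conj_distr_def delta_comb_def dirac_def
      sum_distrib_left mult.assoc)

lemma has_commutator_noise_channel:
  assumes "bosonic_field F"
  shows "has_commutator (noise_channel N \<gamma> \<tau> F) (field_adj (noise_channel N' \<gamma>' \<tau>' F))
    (comb_kernel (delta_comb N \<gamma> \<tau>) (delta_comb N' \<gamma>' \<tau>'))"
  unfolding has_commutator_def
proof (intro ballI allI)
  fix \<phi> \<psi> :: "real \<Rightarrow> complex" and u :: 'a
  assume \<phi>: "\<phi> \<in> test_fun" and \<psi>: "\<psi> \<in> test_fun"
  define a where "a n = complex_of_real (sqrt (\<gamma> n))" for n
  define b where "b n = complex_of_real (sqrt (\<gamma>' n))" for n
  define I where "I n m = (LINT s|lborel. \<phi> s * \<psi> (s - \<tau> n + \<tau>' m))" for n m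
  have F: "operator_distribution F" and FF: "has_commutator F (field_adj F) dirac"
    using assms by (auto simp: bosonic_field_def)
  have lin: "clinear (F g)" "clinear (field_adj F g)" if g: "g \<in> test_fun" for g
  proof -
    show "clinear (F g)"
      using F g by (simp add: operator_distribution_def)
    obtain Y where "is_adjoint (F (\<lambda>x. cnj (g x))) Y"
      using F test_fun_cnj[OF g] unfolding operator_distribution_def by blast
    then show "clinear (field_adj F g)"
      by (simp add: field_adj_def adj_eqI is_adjoint_clinear)
  qed
  have comm: "commutator (F (\<lambda>s. \<phi> (s + \<tau> n))) (field_adj F (\<lambda>s. \<psi> (s + \<tau>' m))) u = I n m *\<^sub>C u"
    for n m
  proof -
    \<comment> \<open>Substituting \<open>s + \<tau> n\<close> for \<open>s\<close> frees \<phi> of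
      its shift, so that it becomes a common factor of all terms, as the kernel form
      requires.\<close>
    have "(LINT s|lborel. \<phi> (s + \<tau> n) * \<psi> (s + \<tau>' m)) = I n m"
      using lborel_integral_real_affine[of 1 "\<lambda>s. \<phi> s * \<psi> (s - \<tau> n + \<tau>' m)" "\<tau> n"]
      by (simp add: I_def add.commute)
    with FF show ?thesis
      using test_fun_shift[OF \<phi>] test_fun_shift[OF \<psi>]
      by (simp add: has_commutator_def dirac_def)
  qed
  have "commutator (noise_channel N \<gamma> \<tau> F \<phi>) (field_adj (noise_channel N' \<gamma>' \<tau>' F) \<psi>) u =
      (\<Sum>n=1..N. \<Sum>m=1..N'. (a n * b m) *\<^sub>C
        commutator (F (\<lambda>s. \<phi> (s + \<tau> n))) (field_adj F (\<lambda>s. \<psi> (s + \<tau>' m))) u)"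
    unfolding field_adj_noise_channel[OF F \<psi>]
    unfolding noise_channel_def[abs_def] a_def b_def
    by (rule commutator_sum) (simp_all add: lin test_fun_shift \<phi> \<psi>)
  also have "\<dots> = (\<Sum>n=1..N. \<Sum>m=1..N'. a n * b m * I n m) *\<^sub>C u"
    by (simp add: comm complex_vector.scale_sum_left)
  also have "(\<Sum>n=1..N. \<Sum>m=1..N'. a n * b m * I n m) =
      (LINT s|lborel. (\<Sum>n=1..N. \<Sum>m=1..N'. a n * b m * (\<phi> s * \<psi> (s - \<tau> n + \<tau>' m))))"
  proof -
    \<comment> \<open>The two delays combine into the single translation
      \<open>\<tau>' m - \<tau> n\<close> of \<psi>.\<close>
    have int: "integrable lborel (\<lambda>s. a n * b m * (\<phi> s * \<psi> (s - \<tau> n + \<tau>' m)))" for n m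
      using integrable_test_fun_mult[OF \<phi> test_fun_shift[OF \<psi>, of "\<tau>' m - \<tau> n"]]
      by (intro integrable_mult_right) (simp add: algebra_simps)
    show ?thesis
      by (simp add: int I_def Bochner_Integration.integral_sum)
  qed
  also have "\<dots> = (LINT s|lborel. \<phi> s *
      comb_kernel (delta_comb N \<gamma> \<tau>) (delta_comb N' \<gamma>' \<tau>') s \<psi>)"
    by (simp add: comb_kernel_delta_comb a_def b_def sum_distrib_left mult_ac)
  finally show "commutator (noise_channel N \<gamma> \<tau> F \<phi>) (field_adj (noise_channel N' \<gamma>' \<tau>' F) \<psi>) u =
    (LINT s|lborel. \<phi> s * comb_kernel (delta_comb N \<gamma> \<tau>) (delta_comb N' \<gamma>' \<tau>') s \<psi>) *\<^sub>C u" .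
qed

text \<open>This is the pairing in \<open>has_commutator\<close> with both test functions equal to
  the indicator of the time step.\<close>

lemma box_integral_eq:
  "box_integral K t dt = (LINT s|lborel. indicator {t..t + dt} s * K s (indicator {t..t + dt}))"
  unfolding box_integral_def set_lebesgue_integral_def
  by (intro Bochner_Integration.integral_cong) (auto simp: indicator_def)


section \<open>Ito products\<close>

text \<open>Stated for any bosonic field that kills the vacuum next to every atomic state, so that
  one argument serves both directions of propagation. All \<xi> are required because the bra in
  \<open>ito_eq\<close> ranges over them.\<close>

lemma ito_noise_channel:
  fixes T :: "'a::complex_inner \<Rightarrow> 'r \<Rightarrow> 'l \<Rightarrow> 'h::complex_inner"
  assumes F: "bosonic_field F"
    and vac: "\<And>\<phi> \<xi>. \<phi> \<in> test_fun \<Longrightarrow> F \<phi> (T \<xi> vac\<^sub>R vac\<^sub>L) = 0"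
    and X: "X = increment (noise_channel N \<gamma> \<tau> F) t dt"
    and Y: "Y = increment (noise_channel N' \<gamma>' \<tau>' F) t dt"
  shows "ito_eq T vac\<^sub>R vac\<^sub>L (T \<psi> vac\<^sub>R vac\<^sub>L) (X \<circ> adj Y)
      (\<lambda>u. box_integral (comb_kernel (delta_comb N \<gamma> \<tau>) (delta_comb N' \<gamma>' \<tau>')) t dt *\<^sub>C u)"
    and "ito_eq T vac\<^sub>R vac\<^sub>L (T \<psi> vac\<^sub>R vac\<^sub>L) (X \<circ> Y) (\<lambda>u. 0)"
    and "ito_eq T vac\<^sub>R vac\<^sub>L (T \<psi> vac\<^sub>R vac\<^sub>L) (adj X \<circ> adj Y) (\<lambda>u. 0)"
    and "ito_eq T vac\<^sub>R vac\<^sub>L (T \<psi> vac\<^sub>R vac\<^sub>L) (adj Y \<circ> X) (\<lambda>u. 0)"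
proof -
  let ?e = "indicator {t..t + dt} :: real \<Rightarrow> complex"
  have dist: "operator_distribution F"
    using F by (simp add: bosonic_field_def)
  have adj: "is_adjoint X (adj X)" "is_adjoint Y (adj Y)"
    unfolding X Y increment_def by (rule adj_noise_channel(1)[OF dist test_fun_indicator])+
  have annihilate: "X (T \<xi> vac\<^sub>R vac\<^sub>L) = 0" "Y (T \<xi> vac\<^sub>R vac\<^sub>L) = 0" for \<xi>
    unfolding X Y increment_def noise_channel_def
    by (simp_all add: vac test_fun_shift[OF test_fun_indicator])
  \<comment> \<open>Moving the creator to the bra turns it into an annihilator acting on the
    vacuum.\<close>
  have creator: "cinner (T \<xi> vac\<^sub>R vac\<^sub>L) (adj X v) = 0" "cinner (T \<xi> vac\<^sub>R vac\<^sub>L) (adj Y v) = 0" for \<xi> v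
    using adj annihilate unfolding is_adjoint_def by (metis cinner_zero_left)+
  \<comment> \<open>In \<open>X \<circ> Y\<close> the vector reaching \<open>X\<close> is already 0,
    so linearity of \<open>X\<close> finishes that case.\<close>
  have X0: "X 0 = 0"
    unfolding X increment_def noise_channel_def
    using dist test_fun_shift[OF test_fun_indicator]
    by (simp add: operator_distribution_def clinear_zero)
  \<comment> \<open>The indicator is real, so the adjoint increment is the creation field smeared
    with the same indicator.\<close>
  have "(\<lambda>x. cnj (?e x)) = ?e"
    by (auto simp: indicator_def)
  then have adjY: "adj Y = field_adj (noise_channel N' \<gamma>' \<tau>' F) ?e"
    by (simp add: Y increment_def field_adj_def)
  have comm: "commutator X (adj Y) u =
      box_integral (comb_kernel (delta_comb N \<gamma> \<tau>) (delta_comb N' \<gamma>' \<tau>')) t dt *\<^sub>C u" for u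
    using has_commutator_noise_channel[OF F] test_fun_indicator[of t dt]
    unfolding adjY box_integral_eq has_commutator_def by (simp add: X increment_def)
  show "ito_eq T vac\<^sub>R vac\<^sub>L (T \<psi> vac\<^sub>R vac\<^sub>L) (X \<circ> adj Y)
      (\<lambda>u. box_integral (comb_kernel (delta_comb N \<gamma> \<tau>) (delta_comb N' \<gamma>' \<tau>')) t dt *\<^sub>C u)"
    \<comment> \<open>Read backwards, \<open>comm\<close> turns the scalar into the commutator; its
      reversed product \<open>adj Y (X u)\<close> has a creator leftmost and drops out by
      \<open>creator\<close>.\<close>
    unfolding ito_eq_def comm[symmetric]
    by (simp add: commutator_def cinner_diff_right creator)
  show "ito_eq T vac\<^sub>R vac\<^sub>L (T \<psi> vac\<^sub>R vac\<^sub>L) (X \<circ> Y) (\<lambda>u. 0)"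
    by (simp add: ito_eq_def annihilate X0)
  show "ito_eq T vac\<^sub>R vac\<^sub>L (T \<psi> vac\<^sub>R vac\<^sub>L) (adj X \<circ> adj Y) (\<lambda>u. 0)"
    "ito_eq T vac\<^sub>R vac\<^sub>L (T \<psi> vac\<^sub>R vac\<^sub>L) (adj Y \<circ> X) (\<lambda>u. 0)"
    by (simp_all add: ito_eq_def creator)
qed

text \<open>Each field acts on its own tensor factor and sends that vacuum to 0; a product vector
  with a zero factor is 0 by linearity of \<open>T\<close> in that slot.\<close>

lemma (in waveguide) annihilate_vacuum:
  assumes "\<phi> \<in> test_fun"
  shows "c_in \<phi> (T \<xi> vac\<^sub>R vac\<^sub>L) = 0" "d_in \<phi> (T \<xi> vac\<^sub>R vac\<^sub>L) = 0"
  using right_field[OF assms] left_field[OF assms]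
    clinear_zero[OF linear_right[of \<xi> vac\<^sub>L]] clinear_zero[OF linear_left[of \<xi> vac\<^sub>R]]
  by auto

theorem theorem4:
  fixes T :: "'n::finite atoms \<Rightarrow> 'r::complex_inner \<Rightarrow> 'l::complex_inner \<Rightarrow> 'h::complex_inner"
    and vac\<^sub>R :: 'r and vac\<^sub>L :: 'l and c_in d_in :: "'h field"
    and \<psi>\<^sub>0 :: "'n atoms" and \<Psi>\<^sub>0 :: 'h
    and N :: "'n \<Rightarrow> nat" and z \<gamma>\<^sub>R \<gamma>\<^sub>L :: "'n \<Rightarrow> nat \<Rightarrow> real" and c :: real
    and c_m d_m :: "'n \<Rightarrow> 'h field" and dC dD :: "'n \<Rightarrow> 'h operator"
    and \<eta>\<^sub>R \<eta>\<^sub>L :: "'n \<Rightarrow> distr"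
    and t dt :: real and j l :: 'n
  assumes "waveguide T vac\<^sub>R vac\<^sub>L c_in d_in"
    and "c > 0"
    and "\<And>j. N j \<ge> 1"
    and "\<And>j. strict_mono_on {1..N j} (z j)"
    and "\<And>j n. n \<in> {1..N j} \<Longrightarrow> \<gamma>\<^sub>R j n \<ge> 0 \<and> \<gamma>\<^sub>L j n \<ge> 0"
    and c_m: "\<And>j. c_m j = noise_channel (N j) (\<gamma>\<^sub>R j) (\<lambda>n. z j n / c) c_in"
    and d_m: "\<And>j. d_m j = noise_channel (N j) (\<gamma>\<^sub>L j) (\<lambda>n. - (z j n / c)) d_in"
    and \<eta>\<^sub>R: "\<And>j. \<eta>\<^sub>R j = delta_comb (N j) (\<gamma>\<^sub>R j) (\<lambda>n. z j n / c)"
    and \<eta>\<^sub>L: "\<And>j. \<eta>\<^sub>L j = delta_comb (N j) (\<gamma>\<^sub>L j) (\<lambda>n. - (z j n / c))"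
    and "t \<ge> 0" and "dt > 0"
    and dC: "\<And>j. dC j = increment (c_m j) t dt"
    and dD: "\<And>j. dD j = increment (d_m j) t dt"
    and "cinner \<psi>\<^sub>0 \<psi>\<^sub>0 = 1"
    and "\<Psi>\<^sub>0 = T \<psi>\<^sub>0 vac\<^sub>R vac\<^sub>L"
  shows "has_commutator (c_m j) (field_adj (c_m l)) (comb_kernel (\<eta>\<^sub>R j) (\<eta>\<^sub>R l)) \<and>
    has_commutator (d_m j) (field_adj (d_m l)) (comb_kernel (\<eta>\<^sub>L j) (\<eta>\<^sub>L l)) \<and>
    ito_eq T vac\<^sub>R vac\<^sub>L \<Psi>\<^sub>0 (dC j \<circ> adj (dC l))
      (\<lambda>u. box_integral (comb_kernel (\<eta>\<^sub>R j) (\<eta>\<^sub>R l)) t dt *\<^sub>C u) \<and>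
    ito_eq T vac\<^sub>R vac\<^sub>L \<Psi>\<^sub>0 (dD j \<circ> adj (dD l))
      (\<lambda>u. box_integral (comb_kernel (\<eta>\<^sub>L j) (\<eta>\<^sub>L l)) t dt *\<^sub>C u) \<and>
    ito_eq T vac\<^sub>R vac\<^sub>L \<Psi>\<^sub>0 (dC j \<circ> dC l) (\<lambda>u. 0) \<and>
    ito_eq T vac\<^sub>R vac\<^sub>L \<Psi>\<^sub>0 (adj (dC j) \<circ> adj (dC l)) (\<lambda>u. 0) \<and>
    ito_eq T vac\<^sub>R vac\<^sub>L \<Psi>\<^sub>0 (adj (dC l) \<circ> dC j) (\<lambda>u. 0) \<and>
    ito_eq T vac\<^sub>R vac\<^sub>L \<Psi>\<^sub>0 (dD j \<circ> dD l) (\<lambda>u. 0) \<and>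
    ito_eq T vac\<^sub>R vac\<^sub>L \<Psi>\<^sub>0 (adj (dD j) \<circ> adj (dD l)) (\<lambda>u. 0) \<and>
    ito_eq T vac\<^sub>R vac\<^sub>L \<Psi>\<^sub>0 (adj (dD l) \<circ> dD j) (\<lambda>u. 0)"
proof -
  interpret waveguide T vac\<^sub>R vac\<^sub>L c_in d_in by fact
  note C = ito_noise_channel[where T = T and vac\<^sub>R = vac\<^sub>R and vac\<^sub>L = vac\<^sub>L,
      OF bosonic(1) annihilate_vacuum(1) dC[of j, unfolded c_m] dC[of l, unfolded c_m]]
  \<comment> \<open>Left-moving channels are the same construction with negative delays
    \<open>- (z j n / c)\<close>; the sign of a delay is unrestricted in the lemma.\<close>
  note D = ito_noise_channel[where T = T and vac\<^sub>R = vac\<^sub>R and vac\<^sub>L = vac\<^sub>L,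
      OF bosonic(2) annihilate_vacuum(2) dD[of j, unfolded d_m] dD[of l, unfolded d_m]]
  show ?thesis
    unfolding \<open>\<Psi>\<^sub>0 = _\<close> c_m d_m \<eta>\<^sub>R \<eta>\<^sub>L
    by (intro conjI has_commutator_noise_channel bosonic C D)
qed

end
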